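(* The bimodal formula $\Phi(x):=(\nu_z.\langle v\rangle x\wedge\langle h\rangle z)\vee[v]\bot$ (actions $\{h,v\}$) has closure ordinal $\omega_1$.
   Context: Modal $\mu$-calculus with standard Kripke semantics on models $\mathcal{M}=(|\mathcal{M}|,R_h,R_v,v)$. $\Phi_{\mathcal{M}}$ is $S\mapsto[\![\Phi]\!]_{\mathcal{M}[x\mapsto S]}$, with approximants $\Phi_{\mathcal{M}}^0(\emptyset)=\emptyset$, $\Phi_{\mathcal{M}}^{\alpha+1}(\emptyset)=\Phi_{\mathcal{M}}(\Phi_{\mathcal{M}}^\alpha(\emptyset))$, unions at limits. An ordinal $\alpha$ is the closure ordinal of $\Phi(x)$ if in every model $\Phi_{\mathcal{M}}^\alpha(\emptyset)$ is a fixed point of $\Phi_{\mathcal{M}}$, and in some model $\alpha$ is the least ordinal $\gamma$ with $\Phi_{\mathcal{M}}^\gamma(\emptyset)=\Phi_{\mathcal{M}}^{\gamma+1}(\emptyset)$. $\omega_1$ is the least uncountable ordinal. *)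

theory Defs
  imports "HOL-Library.Countable_Set"
begin

unbundle cardinal_syntax

section \<open>Ordinals\<close>

text \<open>
  Order types of the well-orders whose field is a subset of the type \<open>'k\<close>, i.e. the ordinals
  of cardinality at most that of \<open>'k\<close>. The relations \<open>=o\<close>, \<open>\<le>o\<close> and \<open><o\<close> entail that both
  sides are well-orders.
\<close>

quotient_type 'k ordinal = "'k rel" / partial: "\<lambda>r s. r =o s"
proof (rule part_equivpI)
  show "\<exists>r :: 'k rel. r =o r"
    using card_of_Well_order ordIso_reflexive by blast
  show "symp (\<lambda>r s :: 'k rel. r =o s)"
    by (simp add: ordIso_symmetric symp_def)
  show "transp (\<lambda>r s :: 'k rel. r =o s)"
    by (auto simp: transp_def intro: ordIso_transitive)
qed

lemma ordIso_Well_order: "r =o s \<Longrightarrow> Well_order r \<and> Well_order s"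
  unfolding ordIso_def by auto

lemma ordinal_cases:
  obtains r where "Well_order r" "x = abs_ordinal r"
proof -
  have "rep_ordinal x =o rep_ordinal x" "abs_ordinal (rep_ordinal x) = x"
    using Quotient3_ordinal unfolding Quotient3_def by blast+
  then show ?thesis
    using that[of "rep_ordinal x"] ordIso_Well_order[of "rep_ordinal x" "rep_ordinal x"] by simp
qed

instantiation ordinal :: (type) wellorder
begin

lift_definition less_eq_ordinal :: "'k ordinal \<Rightarrow> 'k ordinal \<Rightarrow> bool" is "\<lambda>r s. r \<le>o s"
  by (meson ordIso_ordLeq_trans ordIso_symmetric ordLeq_ordIso_trans)

lift_definition less_ordinal :: "'k ordinal \<Rightarrow> 'k ordinal \<Rightarrow> bool" is "\<lambda>r s. r <o s"
  by (meson ordIso_ordLess_trans ordIso_symmetric ordLess_ordIso_trans)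

instance
proof
  fix x y z :: "'k ordinal"
  show "x < y \<longleftrightarrow> x \<le> y \<and> \<not> y \<le> x"
    by transfer
      (meson not_ordLess_ordLeq ordIso_iff_ordLeq ordLeq_iff_ordLess_or_ordIso)
  show "x \<le> x"
    by transfer (simp add: ordIso_iff_ordLeq)
  show "x \<le> y \<Longrightarrow> y \<le> z \<Longrightarrow> x \<le> z"
    by transfer (rule ordLeq_transitive)
  show "x \<le> y \<Longrightarrow> y \<le> x \<Longrightarrow> x = y"
    by transfer (simp add: ordIso_iff_ordLeq)
  show "x \<le> y \<or> y \<le> x"
    by transfer (use ordIso_Well_order ordLeq_total in blast)
next
  fix P :: "'k ordinal \<Rightarrow> bool" and x :: "'k ordinal"
  assume step: "\<And>x. (\<And>y. y < x \<Longrightarrow> P y) \<Longrightarrow> P x"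
  have "Well_order r \<longrightarrow> P (abs_ordinal r)" for r :: "'k rel"
  proof (induction r rule: wf_induct_rule[OF wf_ordLess])
    case (1 r)
    show ?case
    proof
      assume r: "Well_order r"
      show "P (abs_ordinal r)"
      proof (rule step)
        fix y :: "'k ordinal"
        assume y: "y < abs_ordinal r"
        obtain s where s: "Well_order s" "y = abs_ordinal s"
          by (rule ordinal_cases)
        then have "s <o r"
          using y r by (simp add: less_ordinal.abs_eq ordIso_reflexive)
        then show "P y"
          using 1 s by blast
      qed
    qed
  qed
  then show "P x"
    by (metis ordinal_cases)
qed

end

definition osucc :: "'o::wellorder \<Rightarrow> 'o" where
  "osucc \<alpha> = (LEAST \<beta>. \<alpha> < \<beta>)"

definition omega1 :: "nat set ordinal" where
  "omega1 = (LEAST \<alpha>. uncountable {..<\<alpha>})"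

text \<open>
  The two least-element operators above range over nonempty sets: \<^typ>\<open>'k ordinal\<close> has no
  largest element when \<open>'k\<close> is infinite, and \<^typ>\<open>nat set ordinal\<close> has uncountable ordinals.
\<close>

lemma osucc_greater: "\<alpha> < \<beta> \<Longrightarrow> \<alpha> < osucc \<alpha>"
  unfolding osucc_def by (rule LeastI)

lemma osucc_least: "\<alpha> < \<beta> \<Longrightarrow> osucc \<alpha> \<le> \<beta>"
  unfolding osucc_def by (rule Least_le)

lemma osucc_inject:
  assumes "\<beta> < \<alpha>" "\<alpha> = osucc \<beta>" "\<gamma> < \<alpha>" "\<alpha> = osucc \<gamma>"
  shows "\<beta> = \<gamma>"
  using assms osucc_least by (metis linorder_neq_iff not_le)

lemma abs_ordinal_less_iff:
  assumes "Well_order r" "Well_order s"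
  shows "abs_ordinal r < abs_ordinal s \<longleftrightarrow> r <o s"
  using assms by (simp add: less_ordinal.abs_eq ordIso_reflexive)

lemma ordinal_no_max:
  assumes "infinite (UNIV :: 'k set)"
  shows "\<exists>\<beta>. (\<alpha> :: 'k ordinal) < \<beta>"
proof -
  obtain r where r: "Well_order r" and \<alpha>: "\<alpha> = abs_ordinal r"
    by (rule ordinal_cases)
  obtain f :: "'k \<Rightarrow> 'k" where f: "inj f" and "range f \<noteq> UNIV"
    using infinite_imp_bij_betw[OF assms, of undefined]
    unfolding bij_betw_def by (metis DiffD2 UNIV_I singletonI)
  then obtain a where a: "a \<notin> range f"
    by auto
  define q where "q = dir_image r f"
  have q: "Well_order q" "r =o q"
    using r f unfolding q_def
    by (auto intro!: Well_order_dir_image dir_image_ordIso simp: inj_on_def)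
  have aq: "a \<notin> Field q"
    using a dir_image_Field[of r f] unfolding q_def by auto
  define s where "s = q \<union> insert a (Field q) \<times> {a}"
  have field_s: "Field s = insert a (Field q)"
    unfolding s_def Field_def by auto
  have sub: "x \<in> Field q \<and> y \<in> Field q" if "(x, y) \<in> q" for x y
    using that unfolding Field_def by auto
  have "Well_order s"
    unfolding well_order_on_def linear_order_on_def partial_order_on_def preorder_on_def
  proof (intro conjI)
    note lin = q(1)[unfolded well_order_on_def linear_order_on_def partial_order_on_def
        preorder_on_def]
    show "s \<subseteq> Field s \<times> Field s"
      unfolding Field_def by auto
    show "Refl s"
      using lin unfolding field_s by (auto simp: refl_on_def s_def)
    show "trans s"
      using lin aq sub unfolding s_def trans_def by blast
    show "antisym s"
      using lin aq sub unfolding s_def antisym_def by blast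
    show "Total s"
      using lin unfolding field_s total_on_def by (auto simp: s_def)
    have "wf (q - Id)"
      using lin by blast
    moreover have "wf (Field q \<times> {a})"
      by (rule wf_no_loop) (use aq in auto)
    moreover have "Domain (q - Id) \<inter> Range (Field q \<times> {a}) = {}"
      using aq sub by auto
    ultimately have "wf ((q - Id) \<union> Field q \<times> {a})"
      by (rule wf_Un)
    moreover have "s - Id = (q - Id) \<union> Field q \<times> {a}"
      using aq unfolding s_def by auto
    ultimately show "wf (s - Id)"
      by simp
  qed
  moreover have "Restr s (underS s a) = q"
    using aq sub unfolding s_def underS_def by auto
  ultimately have "r <o s"
    using r q(2) field_s ordLess_iff_ordIso_Restr[of s r] by auto
  then show ?thesis
    using r \<open>Well_order s\<close> \<alpha> abs_ordinal_less_iff by blast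
qed

lemma less_osucc:
  assumes "infinite (UNIV :: 'k set)"
  shows "(\<alpha> :: 'k ordinal) < osucc \<alpha>"
  using ordinal_no_max[OF assms] osucc_greater by blast

lemma uncountable_ordinal_exists: "\<exists>\<alpha> :: nat set ordinal. uncountable {..<\<alpha>}"
proof -
  define r where "r = |UNIV :: nat set set|"
  have r: "Well_order r" "Field r = UNIV"
    unfolding r_def by (rule card_of_Well_order, rule Field_card_of)
  define g where "g a = abs_ordinal (Restr r (underS r a))" for a
  have wo: "Well_order (Restr r (underS r a))" for a
    using r(1) by (rule Well_order_Restr)
  have lt: "g a < abs_ordinal r" for a
    unfolding g_def using r wo by (simp add: abs_ordinal_less_iff underS_Restr_ordLess)
  have less: "g a < g b" if "(a, b) \<in> r" "a \<noteq> b" for a b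
  proof -
    have wr: "wo_rel r"
      using r(1) by (simp add: wo_rel_def)
    have "underS r a \<subset> underS r b"
      using that wr wo_rel.ANTISYM[OF wr] wo_rel.TRANS[OF wr]
      unfolding underS_def antisym_def trans_def by blast
    then have "Restr r (underS r a) <o Restr r (underS r b)"
      using ofilter_subset_ordLess[OF r(1)] wo_rel.underS_ofilter[OF wr] by blast
    then show ?thesis
      unfolding g_def using wo abs_ordinal_less_iff by blast
  qed
  have "inj g"
  proof (rule injI, rule ccontr)
    fix a b
    assume "g a = g b" "a \<noteq> b"
    moreover have "(a, b) \<in> r \<or> (b, a) \<in> r"
      using r \<open>a \<noteq> b\<close> unfolding well_order_on_def linear_order_on_def total_on_def by auto
    ultimately show False
      using less[of a b] less[of b a] by auto
  qed
  have "uncountable (UNIV :: nat set set)"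
  proof
    assume "countable (UNIV :: nat set set)"
    then have "range (from_nat_into (UNIV :: nat set set)) = Pow UNIV"
      by (simp add: range_from_nat_into)
    then show False
      using Cantors_theorem by blast
  qed
  then have "uncountable (range g)"
    using \<open>inj g\<close> countable_image_inj_on by blast
  then have "uncountable {..<abs_ordinal r}"
    using lt countable_subset[of "range g" "{..<abs_ordinal r}"] by blast
  then show ?thesis
    by blast
qed

unbundle no cardinal_syntax


section \<open>Approximants\<close>

lemma the_pred_less:
  assumes "\<beta> < \<alpha>" "\<alpha> = osucc \<beta>"
  shows "(THE \<beta>. \<beta> < \<alpha> \<and> \<alpha> = osucc \<beta>) < \<alpha>"
proof -
  have "(THE \<beta>. \<beta> < \<alpha> \<and> \<alpha> = osucc \<beta>) = \<beta>"
    using assms osucc_inject[of _ \<alpha> \<beta>] by (intro the_equality) blast+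
  then show ?thesis
    using assms(1) by simp
qed

function approx :: "('w set \<Rightarrow> 'w set) \<Rightarrow> 'o::wellorder \<Rightarrow> 'w set" where
  "approx F \<alpha> =
    (if \<forall>\<beta>. \<alpha> \<le> \<beta> then {}
     else if \<exists>\<beta><\<alpha>. \<alpha> = osucc \<beta> then F (approx F (THE \<beta>. \<beta> < \<alpha> \<and> \<alpha> = osucc \<beta>))
     else (\<Union>\<beta>\<in>{..<\<alpha>}. approx F \<beta>))"
  by auto
termination
  by (relation "inv_image {(x, y). x < y} snd") (auto intro: wf the_pred_less)

declare approx.simps [simp del]

lemma approx_zero: "(\<And>\<beta>. \<alpha> \<le> \<beta>) \<Longrightarrow> approx F \<alpha> = {}"
  by (simp add: approx.simps)

lemma approx_succ:
  assumes "\<alpha> < osucc \<alpha>"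
  shows "approx F (osucc \<alpha>) = F (approx F \<alpha>)"
proof -
  have "(THE \<beta>. \<beta> < osucc \<alpha> \<and> osucc \<alpha> = osucc \<beta>) = \<alpha>"
    using assms osucc_inject[of _ "osucc \<alpha>" \<alpha>] by (intro the_equality) blast+
  moreover have "\<not> (\<forall>\<beta>. osucc \<alpha> \<le> \<beta>)"
    using assms not_le by blast
  moreover have "\<exists>\<beta>. \<beta> < osucc \<alpha> \<and> osucc \<alpha> = osucc \<beta>"
    using assms by blast
  ultimately show ?thesis
    unfolding approx.simps[of F "osucc \<alpha>"] by (simp only: if_True if_False)
qed

lemma approx_limit:
  assumes "\<beta> < \<alpha>" "\<And>\<beta>. \<beta> < \<alpha> \<Longrightarrow> osucc \<beta> < \<alpha>"
  shows "approx F \<alpha> = (\<Union>\<beta>\<in>{..<\<alpha>}. approx F \<beta>)"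
proof -
  have "\<not> (\<forall>\<beta>. \<alpha> \<le> \<beta>)"
    using assms(1) not_le by blast
  moreover have "\<not> (\<exists>\<beta><\<alpha>. \<alpha> = osucc \<beta>)"
    using assms(2) by blast
  ultimately show ?thesis
    unfolding approx.simps[of F \<alpha>] by (simp only: if_True if_False)
qed


section \<open>The modal mu-calculus\<close>

text \<open>
  Formulas are in negation normal form over actions \<open>'a\<close> and variables \<open>'p\<close>; propositional
  letters and fixed-point variables share the type \<open>'p\<close>. A fixed-point binder is meant to bind
  only positive occurrences of its variable.
\<close>

datatype ('a, 'p) fm =
    Var 'p
  | NegVar 'p
  | Top
  | Bot
  | And "('a, 'p) fm" "('a, 'p) fm"
  | Or "('a, 'p) fm" "('a, 'p) fm"
  | Dia 'a "('a, 'p) fm"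
  | Box 'a "('a, 'p) fm"
  | Mu 'p "('a, 'p) fm"
  | Nu 'p "('a, 'p) fm"

primrec positive_in :: "'p \<Rightarrow> ('a, 'p) fm \<Rightarrow> bool" where
  "positive_in y (Var p) \<longleftrightarrow> True"
| "positive_in y (NegVar p) \<longleftrightarrow> p \<noteq> y"
| "positive_in y Top \<longleftrightarrow> True"
| "positive_in y Bot \<longleftrightarrow> True"
| "positive_in y (And \<phi> \<psi>) \<longleftrightarrow> positive_in y \<phi> \<and> positive_in y \<psi>"
| "positive_in y (Or \<phi> \<psi>) \<longleftrightarrow> positive_in y \<phi> \<and> positive_in y \<psi>"
| "positive_in y (Dia a \<phi>) \<longleftrightarrow> positive_in y \<phi>"
| "positive_in y (Box a \<phi>) \<longleftrightarrow> positive_in y \<phi>"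
| "positive_in y (Mu z \<phi>) \<longleftrightarrow> y = z \<or> positive_in y \<phi>"
| "positive_in y (Nu z \<phi>) \<longleftrightarrow> y = z \<or> positive_in y \<phi>"

primrec wf_fm :: "('a, 'p) fm \<Rightarrow> bool" where
  "wf_fm (Var p) \<longleftrightarrow> True"
| "wf_fm (NegVar p) \<longleftrightarrow> True"
| "wf_fm Top \<longleftrightarrow> True"
| "wf_fm Bot \<longleftrightarrow> True"
| "wf_fm (And \<phi> \<psi>) \<longleftrightarrow> wf_fm \<phi> \<and> wf_fm \<psi>"
| "wf_fm (Or \<phi> \<psi>) \<longleftrightarrow> wf_fm \<phi> \<and> wf_fm \<psi>"
| "wf_fm (Dia a \<phi>) \<longleftrightarrow> wf_fm \<phi>"
| "wf_fm (Box a \<phi>) \<longleftrightarrow> wf_fm \<phi>"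
| "wf_fm (Mu z \<phi>) \<longleftrightarrow> positive_in z \<phi> \<and> wf_fm \<phi>"
| "wf_fm (Nu z \<phi>) \<longleftrightarrow> positive_in z \<phi> \<and> wf_fm \<phi>"

record ('a, 'p, 'w) model =
  worlds :: "'w set"
  acc :: "'a \<Rightarrow> 'w rel"
  val :: "'p \<Rightarrow> 'w set"

definition is_model :: "('a, 'p, 'w) model \<Rightarrow> bool" where
  "is_model M \<longleftrightarrow>
    (\<forall>a. acc M a \<subseteq> worlds M \<times> worlds M) \<and> (\<forall>p. val M p \<subseteq> worlds M)"

definition upd :: "('a, 'p, 'w) model \<Rightarrow> 'p \<Rightarrow> 'w set \<Rightarrow> ('a, 'p, 'w) model" where
  "upd M y S = M\<lparr>val := (val M)(y := S)\<rparr>"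

primrec sem :: "('a, 'p) fm \<Rightarrow> ('a, 'p, 'w) model \<Rightarrow> 'w set" where
  "sem (Var p) M = val M p"
| "sem (NegVar p) M = worlds M - val M p"
| "sem Top M = worlds M"
| "sem Bot M = {}"
| "sem (And \<phi> \<psi>) M = sem \<phi> M \<inter> sem \<psi> M"
| "sem (Or \<phi> \<psi>) M = sem \<phi> M \<union> sem \<psi> M"
| "sem (Dia a \<phi>) M = {w \<in> worlds M. \<exists>u. (w, u) \<in> acc M a \<and> u \<in> sem \<phi> M}"
| "sem (Box a \<phi>) M = {w \<in> worlds M. \<forall>u. (w, u) \<in> acc M a \<longrightarrow> u \<in> sem \<phi> M}"
| "sem (Mu z \<phi>) M = \<Inter>{S. S \<subseteq> worlds M \<and> sem \<phi> (upd M z S) \<subseteq> S}"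
| "sem (Nu z \<phi>) M = \<Union>{S. S \<subseteq> worlds M \<and> S \<subseteq> sem \<phi> (upd M z S)}"

definition sem_fun :: "('a, 'p) fm \<Rightarrow> 'p \<Rightarrow> ('a, 'p, 'w) model \<Rightarrow> 'w set \<Rightarrow> 'w set" where
  "sem_fun \<phi> x M = (\<lambda>S. sem \<phi> (upd M x S))"

text \<open>
  HOL does not quantify over types inside a formula, so the two quantifiers over models are
  given separate types of worlds: \<open>'u\<close> for ``in every model'', to be left as a free type
  variable in theorems, and \<open>'w\<close> for ``in some model'', to be instantiated with the type from
  which the worlds of a witness are drawn.
\<close>

definition closure_ordinal ::
  "'u itself \<Rightarrow> 'w itself \<Rightarrow> ('a, 'p) fm \<Rightarrow> 'p \<Rightarrow> 'k ordinal \<Rightarrow> bool" where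
  "closure_ordinal _ _ \<phi> x \<alpha> \<longleftrightarrow>
    (\<forall>M :: ('a, 'p, 'u) model. is_model M \<longrightarrow>
       sem_fun \<phi> x M (approx (sem_fun \<phi> x M) \<alpha>) = approx (sem_fun \<phi> x M) \<alpha>) \<and>
    (\<exists>M :: ('a, 'p, 'w) model. is_model M \<and>
       approx (sem_fun \<phi> x M) \<alpha> = approx (sem_fun \<phi> x M) (osucc \<alpha>) \<and>
       (\<forall>\<gamma><\<alpha>. approx (sem_fun \<phi> x M) \<gamma> \<noteq> approx (sem_fun \<phi> x M) (osucc \<gamma>)))"

datatype act = H | V

definition Phi :: "(act, string) fm" where
  "Phi =
    Or (Nu ''z'' (And (Dia V (Var ''x'')) (Dia H (Var ''z''))))
       (Box V Bot)"

lemma Phi_wf: "wf_fm Phi" and Phi_positive: "positive_in ''x'' Phi"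
  by (simp_all add: Phi_def)

end

theory Submission
  imports Defs
begin

text \<open>
  A world enters the approximants through an infinite \<open>h\<close>-path all of whose worlds have a
  \<open>v\<close>-successor already present. Only countably many \<open>v\<close>-successors are involved, and countably
  many ordinals below \<open>\<omega>\<^sub>1\<close> are bounded below \<open>\<omega>\<^sub>1\<close>; hence the iteration stops at \<open>\<omega>\<^sub>1\<close>. It does not
  stop earlier in the model whose worlds are the pairs \<open>(\<alpha>, n)\<close> with \<open>\<alpha> < \<omega>\<^sub>1\<close>, where
  \<open>h\<close> leads from \<open>(\<alpha>, n)\<close> to \<open>(\<alpha>, n + 1)\<close> and \<open>v\<close> from \<open>(\<alpha>, n)\<close> to \<open>(\<beta>\<^sub>n, 0)\<close> for an enumeration
  \<open>\<beta>\<^sub>0, \<beta>\<^sub>1, \<dots>\<close> of the ordinals below \<open>\<alpha>\<close>: there \<open>(\<alpha>, 0)\<close> enters at stage \<open>\<alpha> + 1\<close>.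
\<close>

section \<open>Approximants of monotone operators\<close>

text \<open>Frees later arguments from the zero, successor and limit cases. At a successor,
  monotonicity lets the last term of the union absorb the earlier ones.\<close>

lemma approx_eq_UN:
  fixes \<alpha> :: "'o::wellorder"
  assumes "mono F"
  shows "approx F \<alpha> = (\<Union>\<beta>\<in>{..<\<alpha>}. F (approx F \<beta>))"
proof (induction \<alpha> rule: less_induct)
  case (less \<alpha>)
  consider "\<And>\<beta>. \<alpha> \<le> \<beta>" | \<beta> where "\<beta> < \<alpha>" "\<alpha> = osucc \<beta>"
    | \<beta> where "\<beta> < \<alpha>" "\<And>\<beta>. \<beta> < \<alpha> \<Longrightarrow> osucc \<beta> < \<alpha>"
    by (metis not_le osucc_least order_le_less)
  then show ?case
  proof cases
    case 1
    then show ?thesis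
      by (auto simp: approx_zero not_less[symmetric])
  next
    case (2 \<beta>)
    have "F (approx F \<gamma>) \<subseteq> F (approx F \<beta>)" if "\<gamma> < \<alpha>" for \<gamma>
    proof -
      have "\<gamma> \<le> \<beta>"
        using that 2 osucc_least by (metis not_le)
      then have "approx F \<gamma> \<subseteq> approx F \<beta>"
        using less[OF that] less[OF 2(1)] by fastforce
      then show ?thesis
        using assms by (rule monoD[rotated])
    qed
    moreover have "approx F \<alpha> = F (approx F \<beta>)"
      using approx_succ[of \<beta> F] 2 by simp
    ultimately show ?thesis
      using 2(1) by blast
  next
    case (3 \<beta>)
    have "approx F \<alpha> = (\<Union>\<beta>\<in>{..<\<alpha>}. \<Union>\<gamma>\<in>{..<\<beta>}. F (approx F \<gamma>))"
      using approx_limit[OF 3, of F] less by (metis (no_types, lifting) SUP_cong lessThan_iff)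
    also have "\<dots> = (\<Union>\<gamma>\<in>{..<\<alpha>}. F (approx F \<gamma>))"
    proof -
      \<comment> \<open>Each \<open>\<gamma> < \<alpha>\<close> lies under
        \<open>osucc \<gamma>\<close>, which at a limit is again below
        \<open>\<alpha>\<close>.\<close>
      have "(\<Union>\<beta>\<in>{..<\<alpha>}. {..<\<beta>}) = {..<\<alpha>}"
        using 3(2) by (blast intro: less_trans osucc_greater)
      then show ?thesis
        by (simp only: SUP_UNION[symmetric])
    qed
    finally show ?thesis .
  qed
qed

lemma approx_mono:
  fixes \<alpha> \<beta> :: "'o::wellorder"
  assumes "mono F" "\<alpha> \<le> \<beta>"
  shows "approx F \<alpha> \<subseteq> approx F \<beta>"
proof -
  have "{..<\<alpha>} \<subseteq> {..<\<beta>}"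
    using assms(2) by simp
  then show ?thesis
    unfolding approx_eq_UN[OF assms(1), of \<alpha>] approx_eq_UN[OF assms(1), of \<beta>]
    by (rule UN_mono) (rule order_refl)
qed

section \<open>Countability and initial segments of ordinals\<close>

lemma uncountable_lessThan_omega1: "uncountable {..<omega1}"
  unfolding omega1_def by (rule LeastI_ex[OF uncountable_ordinal_exists])

lemma countable_lessThan_if_less_omega1:
  assumes "\<alpha> < omega1"
  shows "countable {..<\<alpha>}"
  using not_less_Least[OF assms[unfolded omega1_def]] by blast

text \<open>An unbounded sequence would cover the uncountable \<open>{..<omega1}\<close> by
  countably many countable segments.\<close>

lemma omega1_countable_bound:
  fixes \<beta> :: "nat \<Rightarrow> nat set ordinal"
  assumes "\<And>n. \<beta> n < omega1"
  obtains \<delta> where "\<delta> < omega1" "\<And>n. \<beta> n < \<delta>"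
proof (rule ccontr)
  assume "\<not> thesis"
  then have "\<exists>n. \<delta> \<le> \<beta> n" if "\<delta> < omega1" for \<delta>
    using \<open>\<And>\<delta>. \<delta> < omega1 \<Longrightarrow> (\<And>n. \<beta> n < \<delta>) \<Longrightarrow> thesis\<close> that not_le by blast
  then have "{..<omega1} \<subseteq> (\<Union>n. insert (\<beta> n) {..<\<beta> n})"
    by (auto simp: le_less)
  moreover have "countable (\<Union>n. insert (\<beta> n) {..<\<beta> n})"
    using assms by (simp add: countable_lessThan_if_less_omega1)
  ultimately show False
    using uncountable_lessThan_omega1 countable_subset by blast
qed

text \<open>Each ordinal below \<open>\<alpha>\<close> is the type of a proper initial segment of a
  well-order representing \<open>\<alpha>\<close>, and the point of the cut determines it. This lets
  the witness model live on sets of naturals.\<close>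

lemma ordinal_lessThan_inj:
  fixes \<alpha> :: "'k ordinal"
  obtains f :: "'k ordinal \<Rightarrow> 'k" where "inj_on f {..<\<alpha>}"
proof -
  obtain r where r: "Well_order r" "\<alpha> = abs_ordinal r"
    by (rule ordinal_cases)
  have "\<exists>a. \<beta> = abs_ordinal (Restr r (underS r a))" if "\<beta> < \<alpha>" for \<beta>
  proof -
    obtain s where s: "Well_order s" "\<beta> = abs_ordinal s"
      by (rule ordinal_cases)
    then have "(s, r) \<in> ordLess"
      using that r abs_ordinal_less_iff by blast
    then obtain a where "(s, Restr r (underS r a)) \<in> ordIso"
      using ordLess_iff_ordIso_Restr[OF r(1) s(1)] by blast
    then show ?thesis
      using s(2) Quotient3_rel_abs[OF Quotient3_ordinal] by blast
  qed
  then obtain f where "\<And>\<beta>. \<beta> < \<alpha> \<Longrightarrow> \<beta> = abs_ordinal (Restr r (underS r (f \<beta>)))"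
    by metis
  then have "inj_on f {..<\<alpha>}"
    by (metis inj_onI lessThan_iff)
  then show thesis
    by (rule that)
qed

section \<open>The operator of \<open>Phi\<close> on arbitrary models\<close>

text \<open>Dependent choice extracts an infinite path from a post-fixed point; conversely, the
  range of such a path is a post-fixed point.\<close>

lemma mem_sem_fun_Phi_iff:
  assumes "is_model M"
  shows "w \<in> sem_fun Phi ''x'' M S \<longleftrightarrow>
    w \<in> worlds M \<and> (\<forall>u. (w, u) \<notin> acc M V) \<or>
    (\<exists>p :: nat \<Rightarrow> _. p 0 = w \<and> (\<forall>n. (p n, p (Suc n)) \<in> acc M H \<and> (\<exists>u\<in>S. (p n, u) \<in> acc M V)))"
    (is "_ \<longleftrightarrow> ?dead \<or> ?path")
proof -
  define coind where "coind T \<longleftrightarrow> T \<subseteq> worlds M \<and>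
    (\<forall>t\<in>T. (\<exists>u\<in>S. (t, u) \<in> acc M V) \<and> (\<exists>t'\<in>T. (t, t') \<in> acc M H))" for T
  have nu: "T \<subseteq> worlds (upd M ''x'' S) \<and>
      T \<subseteq> sem (And (Dia V (Var ''x'')) (Dia H (Var ''z''))) (upd (upd M ''x'' S) ''z'' T) \<longleftrightarrow> coind T" for T
    unfolding coind_def by (auto simp: upd_def)
  have "w \<in> sem_fun Phi ''x'' M S \<longleftrightarrow> ?dead \<or> (\<exists>T. w \<in> T \<and> coind T)"
    unfolding sem_fun_def Phi_def sem.simps(6,10) nu by (auto simp: upd_def)
  moreover have "?path" if T: "w \<in> T" "coind T" for T
  proof -
    \<comment> \<open>The clause for \<open>n = 0\<close> in the choice predicate pins the start of
      the path to \<open>w\<close>.\<close>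
    have "\<exists>p. p 0 = w \<and> (\<forall>n. p n \<in> T \<and> (p n, p (Suc n)) \<in> acc M H)"
      using T dependent_nat_choice[of "\<lambda>n t. t \<in> T \<and> (n = 0 \<longrightarrow> t = w)" "\<lambda>_ t t'. (t, t') \<in> acc M H"]
      unfolding coind_def by (metis nat.distinct(1))
    then show ?thesis
      using T(2) unfolding coind_def by blast
  qed
  moreover have "w \<in> range p \<and> coind (range p)"
    if "p 0 = w" "\<forall>n. (p n, p (Suc n)) \<in> acc M H \<and> (\<exists>u\<in>S. (p n, u) \<in> acc M V)" for p :: "nat \<Rightarrow> _"
    using that assms unfolding coind_def is_model_def by blast
  ultimately show ?thesis
    by blast
qed

lemma mono_sem_fun_Phi:
  assumes "is_model M"
  shows "mono (sem_fun Phi ''x'' M)"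
proof (intro monoI subsetI)
  fix S T w
  assume "S \<subseteq> T" "w \<in> sem_fun Phi ''x'' M S"
  then show "w \<in> sem_fun Phi ''x'' M T"
    unfolding mem_sem_fun_Phi_iff[OF assms] by (elim disj_forward ex_forward) blast+
qed

lemma sem_fun_Phi_approx_omega1:
  fixes M :: "(act, string, 'w) model"
  assumes "is_model M"
  shows "sem_fun Phi ''x'' M (approx (sem_fun Phi ''x'' M) omega1) = approx (sem_fun Phi ''x'' M) omega1"
proof -
  define F where "F = sem_fun Phi ''x'' M"
  note mono = mono_sem_fun_Phi[OF assms, folded F_def]
  note iff = mem_sem_fun_Phi_iff[OF assms, folded F_def]
  note UN = approx_eq_UN[OF mono, of omega1]
  have below: "F (approx F \<delta>) \<subseteq> approx F omega1" if "\<delta> < omega1" for \<delta>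
    using that UN by blast
  have "F (approx F omega1) \<subseteq> approx F omega1"
  proof
    fix w
    assume "w \<in> F (approx F omega1)"
    then consider "w \<in> worlds M \<and> (\<forall>u. (w, u) \<notin> acc M V)"
      | p :: "nat \<Rightarrow> 'w" where "p 0 = w" "\<And>n. (p n, p (Suc n)) \<in> acc M H"
        "\<And>n. \<exists>u\<in>approx F omega1. (p n, u) \<in> acc M V"
      unfolding iff by blast
    then show "w \<in> approx F omega1"
    proof cases
      case 1
      \<comment> \<open>A dead end lies in \<open>F S\<close> for every \<open>S\<close>, so any
        stage below \<open>omega1\<close> will do.\<close>
      obtain \<delta> where "\<delta> < omega1"
        using uncountable_lessThan_omega1 by (metis countable_empty ex_in_conv lessThan_iff)
      with 1 show ?thesis
        using below iff by blast
    next
      case (2 p)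
      have "\<exists>\<beta><omega1. \<exists>u\<in>F (approx F \<beta>). (p n, u) \<in> acc M V" for n
        using 2(3)[of n] UN by blast
      then obtain \<beta> where \<beta>: "\<And>n. \<beta> n < omega1"
        "\<And>n. \<exists>u\<in>F (approx F (\<beta> n)). (p n, u) \<in> acc M V"
        by metis
      obtain \<delta> where \<delta>: "\<delta> < omega1" "\<And>n. \<beta> n < \<delta>"
        using omega1_countable_bound \<beta>(1) by metis
      \<comment> \<open>The single stage \<open>\<delta>\<close> contains all the chosen
        \<open>v\<close>-successors, so the same path puts \<open>w\<close> into \<open>F\<close> of
        that stage.\<close>
      have "F (approx F (\<beta> n)) \<subseteq> approx F \<delta>" for n
        using \<delta>(2)[of n] approx_eq_UN[OF mono, of \<delta>] by blast
      then have "w \<in> F (approx F \<delta>)"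
        using \<beta>(2) 2(1,2) unfolding iff by blast
      then show ?thesis
        using below \<delta>(1) by blast
    qed
  qed
  moreover have "approx F omega1 \<subseteq> F (approx F omega1)"
  proof -
    have "F (approx F \<beta>) \<subseteq> F (approx F omega1)" if "\<beta> < omega1" for \<beta>
      using that by (intro monoD[OF mono] approx_mono[OF mono] less_imp_le)
    then show ?thesis
      using UN by blast
  qed
  ultimately show ?thesis
    unfolding F_def by blast
qed

section \<open>The witness model\<close>

text \<open>The type \<open>nat set ordinal\<close> is too large to embed into
  \<open>nat set\<close>, so the coding of pairs is injective only below
  \<open>omega1\<close>.\<close>

locale omega1_model =
  fixes e :: "nat set ordinal \<times> nat \<Rightarrow> 'w"
  assumes inj_e: "inj_on e ({..<omega1} \<times> UNIV)"
begin

text \<open>The test \<open>{..<\<alpha>} \<noteq> {}\<close> matters: \<open>from_nat_into\<close>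
  returns a value even for the empty set, whereas row zero must consist of dead ends.\<close>

definition M :: "(act, string, 'w) model" where
  "M = \<lparr>worlds = e ` ({..<omega1} \<times> UNIV),
    acc = case_act
      {(e (\<alpha>, n), e (\<alpha>, Suc n)) | \<alpha> n. \<alpha> < omega1}
      {(e (\<alpha>, n), e (from_nat_into {..<\<alpha>} n, 0)) | \<alpha> n. \<alpha> < omega1 \<and> {..<\<alpha>} \<noteq> {}},
    val = (\<lambda>_. {})\<rparr>"

lemma e_eq_iff:
  assumes "\<alpha> < omega1" "\<beta> < omega1"
  shows "e (\<alpha>, m) = e (\<beta>, n) \<longleftrightarrow> \<alpha> = \<beta> \<and> m = n"
  using inj_on_eq_iff[OF inj_e, of "(\<alpha>, m)" "(\<beta>, n)"] assms by simp

lemma from_nat_into_less: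
  assumes "{..<\<alpha>} \<noteq> {}"
  shows "from_nat_into {..<\<alpha>} n < (\<alpha> :: nat set ordinal)"
  using from_nat_into[OF assms] by simp

lemma is_model_M: "is_model M"
  unfolding is_model_def
proof (intro conjI allI)
  show "acc M a \<subseteq> worlds M \<times> worlds M" for a
    by (cases a) (auto simp: M_def intro!: imageI less_trans[OF from_nat_into_less])
  show "val M p \<subseteq> worlds M" for p
    by (simp add: M_def)
qed

lemma acc_H_iff:
  assumes "\<alpha> < omega1"
  shows "(e (\<alpha>, n), u) \<in> acc M H \<longleftrightarrow> u = e (\<alpha>, Suc n)"
  using assms by (auto simp: M_def e_eq_iff)

lemma acc_V_iff:
  assumes "\<alpha> < omega1"
  shows "(e (\<alpha>, n), u) \<in> acc M V \<longleftrightarrow> {..<\<alpha>} \<noteq> {} \<and> u = e (from_nat_into {..<\<alpha>} n, 0)"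
  using assms by (auto simp: M_def e_eq_iff)

text \<open>Row \<open>\<alpha>\<close> is the only \<open>h\<close>-path from its first world, and
  as \<open>{..<\<alpha>}\<close> is countable, the \<open>v\<close>-edges along it reach every
  smaller ordinal.\<close>

lemma mem_sem_fun_Phi_M_iff:
  assumes \<alpha>: "\<alpha> < omega1"
  shows "e (\<alpha>, 0) \<in> sem_fun Phi ''x'' M S \<longleftrightarrow> (\<forall>\<delta><\<alpha>. e (\<delta>, 0) \<in> S)"
proof (cases "{..<\<alpha>} = {}")
  case True
  moreover have "e (\<alpha>, 0) \<in> worlds M"
    using \<alpha> by (simp add: M_def)
  ultimately show ?thesis
    using \<alpha> by (auto simp: mem_sem_fun_Phi_iff[OF is_model_M] acc_V_iff)
next
  case False
  have path: "p = (\<lambda>n. e (\<alpha>, n))" if "p 0 = e (\<alpha>, 0)" "\<forall>n. (p n, p (Suc n)) \<in> acc M H" for p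
  proof
    show "p n = e (\<alpha>, n)" for n
      by (induction n) (use that \<alpha> acc_H_iff in metis)+
  qed
  have "e (\<alpha>, 0) \<in> sem_fun Phi ''x'' M S \<longleftrightarrow> (\<forall>n. \<exists>u\<in>S. (e (\<alpha>, n), u) \<in> acc M V)"
  proof
    assume "e (\<alpha>, 0) \<in> sem_fun Phi ''x'' M S"
    then obtain p :: "nat \<Rightarrow> 'w" where "p 0 = e (\<alpha>, 0)" "\<forall>n. (p n, p (Suc n)) \<in> acc M H"
      and S: "\<forall>n. \<exists>u\<in>S. (p n, u) \<in> acc M V"
      using False \<alpha> acc_V_iff unfolding mem_sem_fun_Phi_iff[OF is_model_M] by blast
    then show "\<forall>n. \<exists>u\<in>S. (e (\<alpha>, n), u) \<in> acc M V"
      using path by metis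
  next
    assume "\<forall>n. \<exists>u\<in>S. (e (\<alpha>, n), u) \<in> acc M V"
    then show "e (\<alpha>, 0) \<in> sem_fun Phi ''x'' M S"
      unfolding mem_sem_fun_Phi_iff[OF is_model_M]
      using \<alpha> by (intro disjI2 exI[of _ "\<lambda>n. e (\<alpha>, n)"]) (simp add: acc_H_iff)
  qed
  also have "\<dots> \<longleftrightarrow> (\<forall>n. e (from_nat_into {..<\<alpha>} n, 0) \<in> S)"
    using False \<alpha> by (simp add: acc_V_iff)
  also have "\<dots> \<longleftrightarrow> (\<forall>\<delta>\<in>range (from_nat_into {..<\<alpha>}). e (\<delta>, 0) \<in> S)"
    by blast
  also have "\<dots> \<longleftrightarrow> (\<forall>\<delta><\<alpha>. e (\<delta>, 0) \<in> S)"
    using range_from_nat_into[OF False countable_lessThan_if_less_omega1[OF \<alpha>]] by auto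
  finally show ?thesis .
qed

text \<open>It suffices to follow the first worlds of rows, because every \<open>v\<close>-edge ends
  in one.\<close>

lemma mem_approx_iff:
  fixes \<gamma> :: "nat set ordinal"
  assumes "\<alpha> < omega1"
  shows "e (\<alpha>, 0) \<in> approx (sem_fun Phi ''x'' M) \<gamma> \<longleftrightarrow> \<alpha> < \<gamma>"
  using assms
proof (induction \<gamma> arbitrary: \<alpha> rule: less_induct)
  case (less \<gamma>)
  have "e (\<alpha>, 0) \<in> approx (sem_fun Phi ''x'' M) \<gamma> \<longleftrightarrow>
      (\<exists>\<beta><\<gamma>. \<forall>\<delta><\<alpha>. e (\<delta>, 0) \<in> approx (sem_fun Phi ''x'' M) \<beta>)"
    by (subst approx_eq_UN[OF mono_sem_fun_Phi[OF is_model_M]])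
      (auto simp: mem_sem_fun_Phi_M_iff[OF less.prems])
  also have "\<dots> \<longleftrightarrow> (\<exists>\<beta><\<gamma>. \<forall>\<delta><\<alpha>. \<delta> < \<beta>)"
    using less by (meson less_trans)
  \<comment> \<open>Forwards, \<open>\<delta> = \<beta>\<close> refutes
    \<open>\<beta> < \<alpha>\<close>; backwards, \<open>\<beta> = \<alpha>\<close> works.\<close>
  also have "\<dots> \<longleftrightarrow> \<alpha> < \<gamma>"
    by (meson le_less_trans not_le less_irrefl)
  finally show ?case .
qed

end

lemma omega1_model_nat_set: "\<exists>e :: nat set ordinal \<times> nat \<Rightarrow> nat set. omega1_model e"
proof -
  obtain f :: "nat set ordinal \<Rightarrow> nat set" where f: "inj_on f {..<omega1}"
    by (rule ordinal_lessThan_inj)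
  \<comment> \<open>Even members code the set \<open>A\<close>; the only odd member codes
    \<open>n\<close>.\<close>
  define c where "c A n = (\<lambda>k. 2 * k) ` A \<union> {2 * n + 1}" for A :: "nat set" and n :: nat
  have "A = {k. 2 * k \<in> c A n}" "{n} = {k. 2 * k + 1 \<in> c A n}" for A n
    unfolding c_def by (auto simp: image_iff) (metis double_not_eq_Suc_double)+
  then have c: "A = B \<and> m = n" if "c A m = c B n" for A B m n
    using that by (metis singleton_inject)
  have "inj_on (\<lambda>(\<alpha>, n). c (f \<alpha>) n) ({..<omega1} \<times> UNIV)"
    by (rule inj_onI) (auto dest!: c dest: inj_onD[OF f])
  then show ?thesis
    unfolding omega1_model_def by blast
qed

theorem theorem7p5:
  shows "closure_ordinal TYPE('u) TYPE(nat set) Phi ''x'' omega1"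
  unfolding closure_ordinal_def
proof (intro conjI allI impI)
  fix M :: "(act, string, 'u) model"
  assume "is_model M"
  then show "sem_fun Phi ''x'' M (approx (sem_fun Phi ''x'' M) omega1) =
      approx (sem_fun Phi ''x'' M) omega1"
    by (rule sem_fun_Phi_approx_omega1)
next
  obtain e :: "nat set ordinal \<times> nat \<Rightarrow> nat set" where "omega1_model e"
    using omega1_model_nat_set by blast
  then interpret omega1_model e .
  have succ: "\<alpha> < osucc \<alpha>" for \<alpha> :: "nat set ordinal"
    by (rule less_osucc) (simp add: Finite_Set.finite_set)
  have "approx (sem_fun Phi ''x'' M) omega1 = approx (sem_fun Phi ''x'' M) (osucc omega1)"
    by (simp add: approx_succ[OF succ] sem_fun_Phi_approx_omega1[OF is_model_M])
  \<comment> \<open>The world \<open>e (\<gamma>, 0)\<close> belongs to the later stage but not to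
    the earlier one.\<close>
  moreover have "approx (sem_fun Phi ''x'' M) \<gamma> \<noteq> approx (sem_fun Phi ''x'' M) (osucc \<gamma>)"
    if "\<gamma> < omega1" for \<gamma>
    using mem_approx_iff[OF that] succ by blast
  ultimately show "\<exists>M :: (act, string, nat set) model. is_model M \<and>
      approx (sem_fun Phi ''x'' M) omega1 = approx (sem_fun Phi ''x'' M) (osucc omega1) \<and>
      (\<forall>\<gamma><omega1. approx (sem_fun Phi ''x'' M) \<gamma> \<noteq> approx (sem_fun Phi ''x'' M) (osucc \<gamma>))"
    using is_model_M by blast
qed

end
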